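(* Mean-payoff games can be reduced to average-energy games in polynomial time: there is a polynomial-time algorithm that, given a game $G$, an initial state $s_{init}$ of $G$ and a threshold $t\in\mathbb{Q}$, outputs a game $G'$, a state $s'_{init}$ of $G'$ and a threshold $t'\in\mathbb{Q}$ such that player 1 has a winning strategy from $s_{init}$ in $G$ for $\mathrm{MeanPayoff}(t)$ if and only if player 1 has a winning strategy from $s'_{init}$ in $G'$ for $\mathrm{AvgEnergy}(t')$.
   Context: A game is a tuple $G=(S_1,S_2,E,w)$ where $S_1,S_2$ are disjoint finite sets of states (belonging to player 1 and player 2 respectively), $S=S_1\uplus S_2$, $E\subseteq S\times S$ is a set of edges such that every $s\in S$ has at least one $s'$ with $(s,s')\in E$, and $w\colon E\to\mathbb{Z}$ is a weight function (encoded in binary). A play from $s_{init}$ is an infinite sequence $\pi=s_0s_1\dots$ with $s_0=s_{init}$ and $(s_i,s_{i+1})\in E$; $\pi(n)=s_0\dots s_n$. Energy level $\mathrm{EL}(\pi(n))=\sum_{i=0}^{n-1}w(s_i,s_{i+1})$; mean-payoff $\overline{\mathrm{MP}}(\pi)=\limsup_{n\to\infty}\frac1n\mathrm{EL}(\pi(n))$; average-energy $\overline{\mathrm{AE}}(\pi)=\limsup_{n\to\infty}\frac1n\sum_{i=1}^{n}\mathrm{EL}(\pi(i))$. A strategy of player $i$ maps each finite prefix whose last state is in $S_i$ to a successor of that state. A strategy of player 1 is winning from $s_{init}$ for an objective $\mathcal{W}$ if every play from $s_{init}$ consistent with it belongs to $\mathcal{W}$. $\mathrm{MeanPayoff}(t)=\{\pi\mid\overline{\mathrm{MP}}(\pi)\le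 t\}$ and $\mathrm{AvgEnergy}(t)=\{\pi\mid\overline{\mathrm{AE}}(\pi)\le t\}$. *)

theory Defs
  imports "HOL-Library.Extended_Real" "HOL-Computational_Algebra.Polynomial"
begin

section \<open>Games\<close>

(* The values of weight outside the edge set are irrelevant. *)
record 'v game =
  states1 :: "'v set"
  states2 :: "'v set"
  edges :: "('v \<times> 'v) set"
  weight :: "'v \<times> 'v \<Rightarrow> int"

definition states :: "'v game \<Rightarrow> 'v set" where
  "states G = states1 G \<union> states2 G"

definition is_game :: "'v game \<Rightarrow> bool" where
  "is_game G \<longleftrightarrow> finite (states1 G) \<and> finite (states2 G) \<and> states1 G \<inter> states2 G = {} \<and>
     edges G \<subseteq> states G \<times> states G \<and> (\<forall>s\<in>states G. \<exists>s'. (s, s') \<in> edges G)"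

definition plays :: "'v game \<Rightarrow> 'v \<Rightarrow> (nat \<Rightarrow> 'v) set" where
  "plays G s = {\<pi>. \<pi> 0 = s \<and> (\<forall>i. (\<pi> i, \<pi> (Suc i)) \<in> edges G)}"

definition play_prefix :: "(nat \<Rightarrow> 'v) \<Rightarrow> nat \<Rightarrow> 'v list" where
  "play_prefix \<pi> n = map \<pi> [0..<Suc n]"

definition energy_level :: "'v game \<Rightarrow> (nat \<Rightarrow> 'v) \<Rightarrow> nat \<Rightarrow> int" where
  "energy_level G \<pi> n = (\<Sum>i<n. weight G (\<pi> i, \<pi> (Suc i)))"

definition mean_payoff :: "'v game \<Rightarrow> (nat \<Rightarrow> 'v) \<Rightarrow> ereal" where
  "mean_payoff G \<pi> = limsup (\<lambda>n. ereal (real_of_int (energy_level G \<pi> n) / real n))"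

definition average_energy :: "'v game \<Rightarrow> (nat \<Rightarrow> 'v) \<Rightarrow> ereal" where
  "average_energy G \<pi> =
     limsup (\<lambda>n. ereal ((\<Sum>i = 1..n. real_of_int (energy_level G \<pi> i)) / real n))"

definition MeanPayoff :: "'v game \<Rightarrow> rat \<Rightarrow> (nat \<Rightarrow> 'v) set" where
  "MeanPayoff G t = {\<pi>. mean_payoff G \<pi> \<le> ereal (of_rat t)}"

definition AvgEnergy :: "'v game \<Rightarrow> rat \<Rightarrow> (nat \<Rightarrow> 'v) set" where
  "AvgEnergy G t = {\<pi>. average_energy G \<pi> \<le> ereal (of_rat t)}"

(* In the next two definitions V is the set of states of the player who uses \<sigma>. *)
definition is_strategy :: "'v game \<Rightarrow> 'v set \<Rightarrow> 'v \<Rightarrow> ('v list \<Rightarrow> 'v) \<Rightarrow> bool" where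
  "is_strategy G V s \<sigma> \<longleftrightarrow>
     (\<forall>\<pi>\<in>plays G s. \<forall>n. \<pi> n \<in> V \<longrightarrow> (\<pi> n, \<sigma> (play_prefix \<pi> n)) \<in> edges G)"

definition consistent :: "'v set \<Rightarrow> ('v list \<Rightarrow> 'v) \<Rightarrow> (nat \<Rightarrow> 'v) \<Rightarrow> bool" where
  "consistent V \<sigma> \<pi> \<longleftrightarrow> (\<forall>n. \<pi> n \<in> V \<longrightarrow> \<pi> (Suc n) = \<sigma> (play_prefix \<pi> n))"

definition player1_wins :: "'v game \<Rightarrow> 'v \<Rightarrow> (nat \<Rightarrow> 'v) set \<Rightarrow> bool" where
  "player1_wins G s W \<longleftrightarrow>
     (\<exists>\<sigma>. is_strategy G (states1 G) s \<sigma> \<and>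
          (\<forall>\<pi>\<in>plays G s. consistent (states1 G) \<sigma> \<pi> \<longrightarrow> \<pi> \<in> W))"

section \<open>Deterministic multi-tape Turing machines\<close>

datatype move = MoveLeft | Stay | MoveRight

(* A tape is infinite in both directions and consists of its cells and the head position;
   a blank cell is None. *)
type_synonym 'a tape = "(int \<Rightarrow> 'a option) \<times> int"

(* The transition function maps a control state and the list of scanned symbols (one per tape)
   to the next control state and one pair of written symbol and head movement per tape. *)
record 'a tm =
  tm_tapes :: nat
  tm_states :: "nat set"
  tm_start :: nat
  tm_halt :: nat
  tm_trans :: "nat \<Rightarrow> 'a option list \<Rightarrow> nat \<times> ('a option \<times> move) list"

(* The tape alphabet 'a option is finite because of the sort constraint.
   Tape 0 is the input tape and tape 1 the output tape. *)
definition wf_tm :: "('a :: finite) tm \<Rightarrow> bool" where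
  "wf_tm M \<longleftrightarrow> 2 \<le> tm_tapes M \<and> finite (tm_states M) \<and>
     tm_start M \<in> tm_states M \<and> tm_halt M \<in> tm_states M \<and>
     (\<forall>q\<in>tm_states M. \<forall>as. length as = tm_tapes M \<longrightarrow>
        fst (tm_trans M q as) \<in> tm_states M \<and> length (snd (tm_trans M q as)) = tm_tapes M)"

definition read_tape :: "'a tape \<Rightarrow> 'a option" where
  "read_tape T = fst T (snd T)"

fun move_head :: "move \<Rightarrow> int \<Rightarrow> int" where
  "move_head MoveLeft i = i - 1"
| "move_head Stay i = i"
| "move_head MoveRight i = i + 1"

definition act_tape :: "'a option \<times> move \<Rightarrow> 'a tape \<Rightarrow> 'a tape" where
  "act_tape a T = ((fst T)(snd T := fst a), move_head (snd a) (snd T))"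

definition tm_step :: "'a tm \<Rightarrow> nat \<times> 'a tape list \<Rightarrow> nat \<times> 'a tape list" where
  "tm_step M c =
     (if fst c = tm_halt M then c
      else let r = tm_trans M (fst c) (map read_tape (snd c))
           in (fst r, map2 act_tape (snd r) (snd c)))"

definition word_cells :: "'a list \<Rightarrow> int \<Rightarrow> 'a option" where
  "word_cells x i = (if 0 \<le> i \<and> i < int (length x) then Some (x ! nat i) else None)"

definition tm_init :: "'a tm \<Rightarrow> 'a list \<Rightarrow> nat \<times> 'a tape list" where
  "tm_init M x = (tm_start M, (word_cells x, 0) # replicate (tm_tapes M - 1) (word_cells [], 0))"

(* Halting configurations are fixed points of tm_step, so this means: within at most n steps. *)
definition tm_outputs_within :: "'a tm \<Rightarrow> 'a list \<Rightarrow> 'a list \<Rightarrow> nat \<Rightarrow> bool" where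
  "tm_outputs_within M x y n \<longleftrightarrow>
     (let c = (tm_step M ^^ n) (tm_init M x)
      in fst c = tm_halt M \<and> fst (snd c ! 1) = word_cells y)"

section \<open>Encoding of games with initial state and threshold\<close>

datatype symbol = Bit bool | Minus | Comma | Semicolon | Bar

instance symbol :: finite
proof
  have "(UNIV :: symbol set) \<subseteq> {Bit True, Bit False, Minus, Comma, Semicolon, Bar}"
  proof
    fix a :: symbol
    show "a \<in> {Bit True, Bit False, Minus, Comma, Semicolon, Bar}"
      by (cases a rule: symbol.exhaust) auto
  qed
  then show "finite (UNIV :: symbol set)"
    using finite_subset by blast
qed

(* Binary digits, most significant first and without leading zeros; 0 has the single digit 0. *)
fun binary :: "nat \<Rightarrow> bool list" where
  "binary n = (if n < 2 then [n = 1] else binary (n div 2) @ [odd n])"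

declare binary.simps [simp del]

definition enc_int :: "int \<Rightarrow> symbol list" where
  "enc_int z = (if z < 0 then [Minus] else []) @ map Bit (binary (nat \<bar>z\<bar>))"

definition enc_rat :: "rat \<Rightarrow> symbol list" where
  "enc_rat t = enc_int (fst (quotient_of t)) @ [Comma] @ enc_int (snd (quotient_of t))"

definition enc_state :: "bool list \<Rightarrow> symbol list" where
  "enc_state u = map Bit u"

definition enc_edge :: "bool list \<times> bool list \<times> int \<Rightarrow> symbol list" where
  "enc_edge e = (case e of (u, v, z) \<Rightarrow>
     enc_state u @ [Comma] @ enc_state v @ [Comma] @ enc_int z)"

definition enc_list :: "('b \<Rightarrow> symbol list) \<Rightarrow> 'b list \<Rightarrow> symbol list" where
  "enc_list f xs = concat (map (\<lambda>x. f x @ [Semicolon]) xs) @ [Bar]"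

(* States are named by bit strings. An instance has one encoding for each order in which
   the states and edges are listed; conversely, the code word determines the states, the weighted
   edges, the initial state and the threshold. *)
definition encodes :: "symbol list \<Rightarrow> bool list game \<Rightarrow> bool list \<Rightarrow> rat \<Rightarrow> bool" where
  "encodes x G s t \<longleftrightarrow>
     (\<exists>l1 l2 es. distinct l1 \<and> set l1 = states1 G \<and> distinct l2 \<and> set l2 = states2 G \<and>
        distinct es \<and> set es = {(u, v, weight G (u, v)) | u v. (u, v) \<in> edges G} \<and>
        x = enc_list enc_state l1 @ enc_list enc_state l2 @ enc_list enc_edge es @
            enc_state s @ [Bar] @ enc_rat t)"

end

theory Submission
  imports Defs "HOL-Library.Countable"
begin

text \<open>Replace every edge from \<open>u\<close> to \<open>v\<close> of weight \<open>w\<close> by a path through a fresh state \<open>(u, v)\<close> whose two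
  edges have weights \<open>2 w\<close> and \<open>- 2 w\<close>. Along a play the energy is \<open>0\<close> at the original states and \<open>2 w\<close>
  at the fresh ones, so the sum of the first \<open>2 n\<close> energy levels is \<open>2\<close> times the energy of the original
  play after \<open>n\<close> steps. Hence average-energy in the new game is mean-payoff in the old one, with the
  same threshold. With a bit string \<open>u\<close> renamed by writing a \<open>1\<close> in front of every bit, and \<open>(u, v)\<close>
  named by joining the two new names by a \<open>0\<close>, the reduction is a two-way finite-state transduction with
  boundedly many passes over each part of the input, which a two-tape machine performs in linear time.\<close>

section \<open>The subdivided game\<close>

text \<open>Trades extended reals for eventual real inequalities, so that two averages can be
  compared by real arithmetic. The slack \<open>e\<close> is unavoidable, as no single term need be
  below \<open>t\<close>.\<close>

lemma limsup_ereal_le_iff: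
  "limsup (\<lambda>n. ereal (f n)) \<le> ereal t \<longleftrightarrow> (\<forall>e>0. \<forall>\<^sub>F n in sequentially. f n < t + e)"
proof
  assume le: "limsup (\<lambda>n. ereal (f n)) \<le> ereal t"
  show "\<forall>e>0. \<forall>\<^sub>F n in sequentially. f n < t + e"
  proof (intro allI impI)
    fix e :: real assume "e > 0"
    then have "limsup (\<lambda>n. ereal (f n)) < ereal (t + e)"
      using le by (metis le_less_trans less_add_same_cancel1 less_ereal.simps(1))
    then have "\<forall>\<^sub>F n in sequentially. ereal (f n) < ereal (t + e)"
      by (rule Limsup_lessD)
    then show "\<forall>\<^sub>F n in sequentially. f n < t + e" by simp
  qed
next
  assume ev: "\<forall>e>0. \<forall>\<^sub>F n in sequentially. f n < t + e"
  show "limsup (\<lambda>n. ereal (f n)) \<le> ereal t"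
  proof (rule ereal_le_epsilon2)
    fix e :: real assume "e > 0"
    then have "\<forall>\<^sub>F n in sequentially. ereal (f n) \<le> ereal (t + e)"
      using ev by (auto elim!: eventually_mono)
    then show "limsup (\<lambda>n. ereal (f n)) \<le> ereal t + ereal e"
      by (simp add: Limsup_bounded)
  qed
qed

text \<open>In the application \<open>a n\<close> is the old energy level and \<open>b n\<close> the
  sum of the first \<open>n\<close> new ones. The even terms of \<open>b n / n\<close> are the old
  means. With \<open>c = a (k + 1) / (k + 1)\<close>, the odd term at \<open>n = 2 * k + 1\<close>
  is \<open>c + c / n\<close>, and \<open>c \<le> C\<close> makes the excess at most
  \<open>C / n\<close>.\<close>

lemma limsup_average_subdivided:
  fixes a b :: "nat \<Rightarrow> real"
  assumes bound: "\<And>n. \<bar>a n\<bar> \<le> C * real n"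
    and even: "\<And>n. b (2 * n) = 2 * a n"
    and odd: "\<And>n. b (2 * n + 1) = 2 * a (n + 1)"
  shows "limsup (\<lambda>n. ereal (b n / real n)) \<le> ereal t \<longleftrightarrow>
         limsup (\<lambda>n. ereal (a n / real n)) \<le> ereal t"
proof
  assume "limsup (\<lambda>n. ereal (b n / real n)) \<le> ereal t"
  moreover have "limsup ((\<lambda>n. ereal (b n / real n)) \<circ> (\<lambda>n. 2 * n)) \<le> limsup (\<lambda>n. ereal (b n / real n))"
    by (rule limsup_subseq_mono) (simp add: strict_mono_def)
  moreover have "(\<lambda>n. ereal (b n / real n)) \<circ> (\<lambda>n. 2 * n) = (\<lambda>n. ereal (a n / real n))"
    by (auto simp: fun_eq_iff even)
  ultimately show "limsup (\<lambda>n. ereal (a n / real n)) \<le> ereal t"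
    by (metis order_trans)
next
  assume a_le: "limsup (\<lambda>n. ereal (a n / real n)) \<le> ereal t"
  show "limsup (\<lambda>n. ereal (b n / real n)) \<le> ereal t"
    unfolding limsup_ereal_le_iff
  proof (intro allI impI)
    fix e :: real assume "e > 0"
    have "\<forall>\<^sub>F n in sequentially. a n / real n < t + e / 2"
      using a_le \<open>e > 0\<close> unfolding limsup_ereal_le_iff by simp
    then obtain N where N: "\<And>n. n \<ge> N \<Longrightarrow> a n / real n < t + e / 2"
      unfolding eventually_sequentially by blast
    \<comment> \<open>From index \<open>K\<close> on, \<open>C / n\<close> is below half of the
      slack; the other half is spent on \<open>a n / n\<close>.\<close>
    obtain K :: nat where K: "2 * C / e < real K"
      using reals_Archimedean2 by blast
    have "b n / real n < t + e" if n: "n \<ge> 2 * N + K + 1" for n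
    proof (cases "even n")
      case True
      then obtain k where k: "n = 2 * k" by blast
      then have "k \<ge> N" using n by simp
      from N[OF this] show ?thesis using \<open>e > 0\<close> by (simp add: k even)
    next
      case False
      then obtain k where k: "n = 2 * k + 1" by (elim oddE)
      define c where "c = a (k + 1) / real (k + 1)"
      have "k + 1 \<ge> N" using n k by simp
      from N[OF this] have c: "c < t + e / 2" by (simp add: c_def)
      have a: "a (k + 1) = c * real (k + 1)" by (simp add: c_def)
      have "c * real (k + 1) \<le> C * real (k + 1)"
        using bound[of "k + 1"] unfolding a by linarith
      then have "c \<le> C" by (rule mult_right_le_imp_le) simp
      have "2 * C < e * real n"
      proof -
        have "2 * C < e * real K" using K \<open>e > 0\<close> by (simp add: field_simps)
        also have "\<dots> \<le> e * real n" using \<open>e > 0\<close> n by simp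
        finally show ?thesis .
      qed
      moreover have "b n / real n = c + c / real n"
        using k odd[of k] a by (simp add: field_simps)
      moreover have "c / real n < e / 2"
        using \<open>c \<le> C\<close> calculation(1) k by (simp add: field_simps)
      ultimately show ?thesis using c by linarith
    qed
    then show "\<forall>\<^sub>F n in sequentially. b n / real n < t + e"
      unfolding eventually_sequentially by blast
  qed
qed

section \<open>The subdivision and its states\<close>

text \<open>\<open>d\<close> names the old states and \<open>m\<close> the fresh ones. Keeping the
  names abstract separates the argument about games from bit strings; only injectivity and disjoint
  ranges matter, and \<open>pad\<close> and \<open>mid\<close> are substituted at the end.\<close>

locale subdivided_game =
  fixes G :: "'v game" and d :: "'v \<Rightarrow> 'w" and m :: "'v \<times> 'v \<Rightarrow> 'w"
  assumes game: "is_game G" and inj_d: "inj d" and inj_m: "inj m"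
    and d_neq_m [simp]: "d u \<noteq> m p"
begin

lemma m_neq_d [simp]: "m p \<noteq> d u"
  by (metis d_neq_m)

lemma d_eq_iff [simp]: "d u = d v \<longleftrightarrow> u = v"
  using inj_d by (simp add: inj_eq)

lemma m_eq_iff [simp]: "m p = m q \<longleftrightarrow> p = q"
  using inj_m by (simp add: inj_eq)

lemma inv_d [simp]: "inv d (d u) = u"
  using inj_d by simp

lemma inv_m [simp]: "inv m (m p) = p"
  using inj_m by simp

text \<open>A fresh state has a single successor, so its owner has no choice there; giving it to
  player 2 leaves player 1 with turns at old states only. The weight recovers the old edge from
  whichever endpoint is fresh.\<close>

definition subdivision :: "'w game" where
  "subdivision =
     \<lparr>states1 = d ` states1 G, states2 = d ` states2 G \<union> m ` edges G,
      edges = {(d u, m (u, v)) | u v. (u, v) \<in> edges G} \<union> {(m (u, v), d v) | u v. (u, v) \<in> edges G},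
      weight = (\<lambda>(x, y). if x \<in> range d then 2 * weight G (inv m y) else - (2 * weight G (inv m x)))\<rparr>"

lemma weight_subdivision [simp]:
  "weight subdivision (d u, m p) = 2 * weight G p"
  "weight subdivision (m p, d v) = - (2 * weight G p)"
  by (auto simp: subdivision_def)

lemma edges_subdivision [simp]:
  "(d u, y) \<in> edges subdivision \<longleftrightarrow> (\<exists>v. y = m (u, v) \<and> (u, v) \<in> edges G)"
  "(m (u, v), y) \<in> edges subdivision \<longleftrightarrow> y = d v \<and> (u, v) \<in> edges G"
  by (auto simp: subdivision_def)

lemma states1_subdivision [simp]:
  "d u \<in> states1 subdivision \<longleftrightarrow> u \<in> states1 G"
  "m p \<notin> states1 subdivision"
  by (auto simp: subdivision_def)

lemma finite_edges: "finite (edges G)"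
proof (rule finite_subset)
  show "edges G \<subseteq> states G \<times> states G" using game by (simp add: is_game_def)
  show "finite (states G \<times> states G)" using game by (simp add: is_game_def states_def)
qed

lemma d_in_states_subdivision: "u \<in> states G \<Longrightarrow> d u \<in> states subdivision"
  by (auto simp: states_def subdivision_def)

lemma m_in_states_subdivision: "p \<in> edges G \<Longrightarrow> m p \<in> states subdivision"
  by (auto simp: states_def subdivision_def)

lemma is_game_subdivision: "is_game subdivision"
proof -
  have fin: "finite (states1 G)" "finite (states2 G)" and disj: "states1 G \<inter> states2 G = {}"
    and sub: "edges G \<subseteq> states G \<times> states G" and succ: "\<forall>s\<in>states G. \<exists>s'. (s, s') \<in> edges G"
    using game by (auto simp: is_game_def)
  have "states1 subdivision \<inter> states2 subdivision = {}"
    using disj by (auto simp: subdivision_def)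
  moreover have "edges subdivision \<subseteq> states subdivision \<times> states subdivision"
  proof -
    have "d u \<in> states subdivision \<and> d v \<in> states subdivision \<and> m (u, v) \<in> states subdivision"
      if "(u, v) \<in> edges G" for u v
      using that sub d_in_states_subdivision m_in_states_subdivision by blast
    then show ?thesis by (auto simp: subdivision_def)
  qed
  moreover have "\<exists>y. (x, y) \<in> edges subdivision" if "x \<in> states subdivision" for x
  proof -
    have "(\<exists>u\<in>states G. x = d u) \<or> (\<exists>p\<in>edges G. x = m p)"
      using that by (auto simp: states_def subdivision_def)
    then show ?thesis using succ by (auto simp: subdivision_def)
  qed
  ultimately show ?thesis
    using fin finite_edges unfolding is_game_def by (simp add: subdivision_def)
qed

section \<open>Correspondence of plays and histories\<close>

definition expand :: "(nat \<Rightarrow> 'v) \<Rightarrow> nat \<Rightarrow> 'w" where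
  "expand \<pi> i = (if even i then d (\<pi> (i div 2)) else m (\<pi> (i div 2), \<pi> (Suc (i div 2))))"

definition contract :: "(nat \<Rightarrow> 'w) \<Rightarrow> nat \<Rightarrow> 'v" where
  "contract \<rho> i = inv d (\<rho> (2 * i))"

lemma expand_simps [simp]:
  "expand \<pi> (2 * k) = d (\<pi> k)"
  "expand \<pi> (Suc (2 * k)) = m (\<pi> k, \<pi> (Suc k))"
  by (simp_all add: expand_def)

lemma contract_expand [simp]: "contract (expand \<pi>) = \<pi>"
  by (simp add: contract_def fun_eq_iff)

lemma all_nat_even_odd: "(\<forall>i. P i) \<longleftrightarrow> (\<forall>k. P (2 * k) \<and> P (Suc (2 * k)))"
proof (intro iffI allI)
  show "P i" if "\<forall>k. P (2 * k) \<and> P (Suc (2 * k))" for i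
    using that by (cases "even i") (auto elim!: evenE oddE)
qed simp

lemma expand_in_plays: "expand \<pi> \<in> plays subdivision (d s) \<longleftrightarrow> \<pi> \<in> plays G s"
proof -
  have "expand \<pi> (Suc (Suc (2 * k))) = d (\<pi> (Suc k))" for k
    using expand_simps(1)[of \<pi> "Suc k"] by simp
  moreover have "expand \<pi> 0 = d (\<pi> 0)" by (simp add: expand_def)
  ultimately show ?thesis
    by (auto simp: plays_def all_nat_even_odd[of "\<lambda>i. (expand \<pi> i, expand \<pi> (Suc i)) \<in> edges subdivision"])
qed

text \<open>Old and fresh states alternate, and a fresh state \<open>m (u, v)\<close> records both
  old states around it. Hence the even positions determine the whole play, and \<open>expand\<close>
  reaches every play from \<open>d s\<close>.\<close>

lemma plays_subdivision_cases:
  assumes \<rho>: "\<rho> \<in> plays subdivision (d s)"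
  obtains \<pi> where "\<pi> \<in> plays G s" "\<rho> = expand \<pi>"
proof -
  have step: "(\<rho> i, \<rho> (Suc i)) \<in> edges subdivision" for i
    using \<rho> by (simp add: plays_def)
  \<comment> \<open>Two moves from an old state end in an old state again, which drives the
    induction on \<open>k\<close>.\<close>
  have two: "\<exists>v. \<rho> (Suc i) = m (u, v) \<and> \<rho> (Suc (Suc i)) = d v" if "\<rho> i = d u" for i u
    using step[of i] step[of "Suc i"] that by auto
  have ex: "\<exists>u. \<rho> (2 * k) = d u" for k
  proof (induction k)
    case 0
    show ?case using \<rho> by (auto simp: plays_def)
  next
    case (Suc k)
    then show ?case using two by fastforce
  qed
  have even: "\<rho> (2 * k) = d (contract \<rho> k)" for k
    using ex[of k] by (auto simp: contract_def)
  have "\<rho> (Suc (2 * k)) = m (contract \<rho> k, contract \<rho> (Suc k))" for k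
    using two[OF even[of k]] even[of "Suc k"] by auto
  then have "\<rho> = expand (contract \<rho>)"
    using even by (simp add: fun_eq_iff all_nat_even_odd[of "\<lambda>i. \<rho> i = expand (contract \<rho>) i"])
  then show thesis
    using that[of "contract \<rho>"] \<rho> expand_in_plays by metis
qed

text \<open>A history is treated as a play through \<open>(!) g\<close>. After \<open>n\<close>
  steps it has length \<open>n + 1\<close>, and its expansion ends at position
  \<open>2 * n\<close>.\<close>

definition expand_history :: "'v list \<Rightarrow> 'w list" where
  "expand_history g = play_prefix (expand ((!) g)) (2 * (length g - 1))"

definition contract_history :: "'w list \<Rightarrow> 'v list" where
  "contract_history h = play_prefix (contract ((!) h)) ((length h - 1) div 2)"

lemma expand_history_prefix: "expand_history (play_prefix \<pi> n) = play_prefix (expand \<pi>) (2 * n)"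
proof -
  have nth: "play_prefix \<pi> n ! i = \<pi> i" if "i \<le> n" for i
    using that by (simp add: play_prefix_def del: upt_Suc)
  \<comment> \<open>An odd position below \<open>2 * n\<close> looks one state ahead, and that state
    is still in the list; values of \<open>(!)\<close> past its end are never read.\<close>
  have "expand ((!) (play_prefix \<pi> n)) i = expand \<pi> i" if "i \<le> 2 * n" for i
    using that by (auto simp: expand_def nth elim!: evenE oddE)
  then show ?thesis
    by (simp add: expand_history_def play_prefix_def del: upt_Suc)
qed

lemma contract_history_prefix:
  "contract_history (play_prefix (expand \<pi>) (2 * n)) = play_prefix \<pi> n"
proof -
  have "play_prefix (expand \<pi>) (2 * n) ! (2 * i) = d (\<pi> i)" if "i \<le> n" for i
    using that by (simp add: play_prefix_def del: upt_Suc)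
  then show ?thesis
    by (simp add: contract_history_def play_prefix_def contract_def del: upt_Suc)
qed

lemma last_play_prefix [simp]: "last (play_prefix \<pi> n) = \<pi> n"
  by (simp add: play_prefix_def)

section \<open>Energy levels along an expanded play\<close>

lemma energy_level_expand:
  "energy_level subdivision (expand \<pi>) (2 * n) = 0"
  "energy_level subdivision (expand \<pi>) (Suc (2 * n)) = 2 * weight G (\<pi> n, \<pi> (Suc n))"
proof -
  show *: "energy_level subdivision (expand \<pi>) (2 * n) = 0"
  proof (induction n)
    case (Suc n)
    then show ?case
      using expand_simps(1)[of \<pi> "Suc n"] by (simp add: energy_level_def)
  qed (simp add: energy_level_def)
  then show "energy_level subdivision (expand \<pi>) (Suc (2 * n)) = 2 * weight G (\<pi> n, \<pi> (Suc n))"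
    by (simp add: energy_level_def)
qed

text \<open>The levels at \<open>2 * n + 1\<close> and \<open>2 * n + 2\<close> contribute twice the
  weight of step \<open>n\<close> and zero, so the induction accumulates twice the old
  energy.\<close>

lemma sum_energy_level_expand:
  "(\<Sum>i = 1..2 * n. real_of_int (energy_level subdivision (expand \<pi>) i)) =
   2 * real_of_int (energy_level G \<pi> n)"
proof (induction n)
  case (Suc n)
  then show ?case
    using energy_level_expand(2)[of \<pi> n] energy_level_expand(1)[of \<pi> "Suc n"]
    by (simp add: energy_level_def[of G])
qed (simp add: energy_level_def)

text \<open>The sum of all absolute edge weights dominates each single weight. This yields the
  linear bound required to control the odd terms of the averages.\<close>

lemma energy_level_bounded:
  obtains C where "\<And>\<pi> n. \<pi> \<in> plays G s \<Longrightarrow> \<bar>real_of_int (energy_level G \<pi> n)\<bar> \<le> C * real n"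
proof -
  define C where "C = (\<Sum>e\<in>edges G. \<bar>weight G e\<bar>)"
  have w: "\<bar>weight G e\<bar> \<le> C" if "e \<in> edges G" for e
    unfolding C_def using finite_edges that by (intro member_le_sum) auto
  have "\<bar>energy_level G \<pi> n\<bar> \<le> C * int n" if "\<pi> \<in> plays G s" for \<pi> n
  proof -
    have "\<bar>energy_level G \<pi> n\<bar> \<le> (\<Sum>i<n. \<bar>weight G (\<pi> i, \<pi> (Suc i))\<bar>)"
      unfolding energy_level_def by (rule sum_abs)
    also have "\<dots> \<le> (\<Sum>i<n. C)"
      using that by (intro sum_mono w) (simp add: plays_def)
    finally show ?thesis by (simp add: mult.commute)
  qed
  then have "\<bar>real_of_int (energy_level G \<pi> n)\<bar> \<le> real_of_int C * real n" if "\<pi> \<in> plays G s" for \<pi> n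
    using that by (metis of_int_abs of_int_le_iff of_int_mult of_int_of_nat_eq)
  then show thesis by (rule that)
qed

lemma average_energy_expand_le_iff:
  assumes "\<pi> \<in> plays G s"
  shows "expand \<pi> \<in> AvgEnergy subdivision t \<longleftrightarrow> \<pi> \<in> MeanPayoff G t"
proof -
  obtain C where C: "\<And>n. \<bar>real_of_int (energy_level G \<pi> n)\<bar> \<le> C * real n"
    using energy_level_bounded assms by metis
  show ?thesis
    unfolding AvgEnergy_def MeanPayoff_def average_energy_def mean_payoff_def mem_Collect_eq
  proof (rule limsup_average_subdivided[OF C sum_energy_level_expand])
    fix n
    \<comment> \<open>The one level beyond an even prefix belongs to a fresh state and already
      carries the full doubled weight, hence the index \<open>n + 1\<close> on the right.\<close>
    show "(\<Sum>i = 1..2 * n + 1. real_of_int (energy_level subdivision (expand \<pi>) i)) =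
          2 * real_of_int (energy_level G \<pi> (n + 1))"
      using sum_energy_level_expand[of \<pi> n] energy_level_expand(2)[of \<pi> n]
      by (simp add: energy_level_def[of G])
  qed
qed

section \<open>Transfer of strategies\<close>

lemma expand_in_states1:
  assumes "expand \<pi> n \<in> states1 subdivision"
  obtains k where "n = 2 * k" "\<pi> k \<in> states1 G"
  using assms by (cases "even n") (auto elim!: evenE oddE)

text \<open>Strategies are carried both ways along the correspondence of histories. Consistent plays
  then correspond, and the two objectives agree play by play.\<close>

lemma player1_wins_subdivision_iff:
  "player1_wins subdivision (d s) (AvgEnergy subdivision t) \<longleftrightarrow> player1_wins G s (MeanPayoff G t)"
proof
  assume "player1_wins G s (MeanPayoff G t)"
  then obtain \<sigma> where \<sigma>: "is_strategy G (states1 G) s \<sigma>"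
    and win: "\<And>\<pi>. \<pi> \<in> plays G s \<Longrightarrow> consistent (states1 G) \<sigma> \<pi> \<Longrightarrow> \<pi> \<in> MeanPayoff G t"
    unfolding player1_wins_def by blast
  \<comment> \<open>Contract the history, ask \<open>\<sigma>\<close> for the next old state and
    move to the fresh state of that edge.\<close>
  define \<tau> where "\<tau> h = m (last (contract_history h), \<sigma> (contract_history h))" for h
  have \<tau>: "\<tau> (play_prefix (expand \<pi>) (2 * k)) = m (\<pi> k, \<sigma> (play_prefix \<pi> k))" for \<pi> k
    by (simp add: \<tau>_def contract_history_prefix)
  have "is_strategy subdivision (states1 subdivision) (d s) \<tau>"
    unfolding is_strategy_def
  proof (intro ballI allI impI)
    fix \<rho> n assume \<rho>: "\<rho> \<in> plays subdivision (d s)" and n: "\<rho> n \<in> states1 subdivision"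
    from \<rho> obtain \<pi> where \<pi>: "\<pi> \<in> plays G s" "\<rho> = expand \<pi>"
      by (rule plays_subdivision_cases)
    obtain k where "n = 2 * k" "\<pi> k \<in> states1 G"
      using n unfolding \<pi>(2) by (rule expand_in_states1)
    then show "(\<rho> n, \<tau> (play_prefix \<rho> n)) \<in> edges subdivision"
      using \<sigma> \<pi> by (simp add: \<tau> is_strategy_def)
  qed
  moreover have "\<rho> \<in> AvgEnergy subdivision t"
    if \<rho>: "\<rho> \<in> plays subdivision (d s)" and con: "consistent (states1 subdivision) \<tau> \<rho>" for \<rho>
  proof -
    from \<rho> obtain \<pi> where \<pi>: "\<pi> \<in> plays G s" "\<rho> = expand \<pi>"
      by (rule plays_subdivision_cases)
    have "\<pi> (Suc k) = \<sigma> (play_prefix \<pi> k)" if "\<pi> k \<in> states1 G" for k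
    proof -
      have "expand \<pi> (2 * k) \<in> states1 subdivision" using that by simp
      then have "expand \<pi> (Suc (2 * k)) = \<tau> (play_prefix (expand \<pi>) (2 * k))"
        using con \<pi>(2) unfolding consistent_def by blast
      then show ?thesis by (simp add: \<tau>)
    qed
    then have "consistent (states1 G) \<sigma> \<pi>" by (simp add: consistent_def)
    then show ?thesis using win \<pi> average_energy_expand_le_iff by simp
  qed
  ultimately show "player1_wins subdivision (d s) (AvgEnergy subdivision t)"
    unfolding player1_wins_def by blast
next
  assume "player1_wins subdivision (d s) (AvgEnergy subdivision t)"
  then obtain \<tau> where \<tau>: "is_strategy subdivision (states1 subdivision) (d s) \<tau>"
    and win: "\<And>\<rho>. \<rho> \<in> plays subdivision (d s) \<Longrightarrow> consistent (states1 subdivision) \<tau> \<rho> \<Longrightarrow>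
                \<rho> \<in> AvgEnergy subdivision t"
    unfolding player1_wins_def by blast
  \<comment> \<open>Read off which edge \<open>\<tau>\<close> enters after the expanded history and
    take its target. Legality of \<open>\<tau>\<close> ensures that its answer is a fresh state
    whose first component is the current state.\<close>
  define \<sigma> where "\<sigma> g = snd (inv m (\<tau> (expand_history g)))" for g
  have \<sigma>: "\<tau> (play_prefix (expand \<pi>) (2 * k)) = m (\<pi> k, \<sigma> (play_prefix \<pi> k))"
          "(\<pi> k, \<sigma> (play_prefix \<pi> k)) \<in> edges G"
    if "\<pi> \<in> plays G s" "\<pi> k \<in> states1 G" for \<pi> k
  proof -
    have "expand \<pi> (2 * k) \<in> states1 subdivision" "expand \<pi> \<in> plays subdivision (d s)"
      using that by (simp_all add: expand_in_plays)
    then have "(expand \<pi> (2 * k), \<tau> (play_prefix (expand \<pi>) (2 * k))) \<in> edges subdivision"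
      using \<tau> unfolding is_strategy_def by blast
    then show "\<tau> (play_prefix (expand \<pi>) (2 * k)) = m (\<pi> k, \<sigma> (play_prefix \<pi> k))"
      "(\<pi> k, \<sigma> (play_prefix \<pi> k)) \<in> edges G"
      by (auto simp: \<sigma>_def expand_history_prefix)
  qed
  have "is_strategy G (states1 G) s \<sigma>"
    using \<sigma>(2) by (simp add: is_strategy_def)
  moreover have "\<pi> \<in> MeanPayoff G t"
    if \<pi>: "\<pi> \<in> plays G s" and con: "consistent (states1 G) \<sigma> \<pi>" for \<pi>
  proof -
    have "expand \<pi> (Suc n) = \<tau> (play_prefix (expand \<pi>) n)" if n: "expand \<pi> n \<in> states1 subdivision" for n
    proof -
      obtain k where k: "n = 2 * k" "\<pi> k \<in> states1 G"
        using n by (rule expand_in_states1)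
      then show ?thesis using con \<sigma>(1)[OF \<pi> k(2)] by (simp add: consistent_def)
    qed
    then have "consistent (states1 subdivision) \<tau> (expand \<pi>)" by (simp add: consistent_def)
    then show ?thesis
      using win[of "expand \<pi>"] \<pi> average_energy_expand_le_iff[OF \<pi>] expand_in_plays by simp
  qed
  ultimately show "player1_wins G s (MeanPayoff G t)"
    unfolding player1_wins_def by blast
qed

end

section \<open>Two-way transducers as Turing machines\<close>

definition emit :: "'a option \<Rightarrow> 'a list" where
  "emit a = (case a of None \<Rightarrow> [] | Some c \<Rightarrow> [c])"

lemma emit_simps [simp]: "emit None = []" "emit (Some c) = [c]"
  by (simp_all add: emit_def)

text \<open>The scanned input symbol is written back unchanged. The output head advances only after
  writing a symbol; writing \<open>None\<close> leaves the blank cell under it blank.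
  \<open>to_nat\<close> turns the finite control type into the required set of numbers.\<close>

definition transducer_tm ::
    "('q :: finite \<Rightarrow> 'a option \<Rightarrow> 'q \<times> 'a option \<times> move) \<Rightarrow> 'q \<Rightarrow> 'q \<Rightarrow> 'a tm" where
  "transducer_tm \<delta> q0 h =
     \<lparr>tm_tapes = 2, tm_states = range (to_nat :: 'q \<Rightarrow> nat), tm_start = to_nat q0, tm_halt = to_nat h,
      tm_trans = (\<lambda>n as. case \<delta> (from_nat n) (as ! 0) of (q, a, mv) \<Rightarrow>
        (to_nat q, [(as ! 0, mv), (a, if a = None then Stay else MoveRight)]))\<rparr>"

lemma wf_transducer_tm: "wf_tm (transducer_tm \<delta> q0 h :: ('a :: finite) tm)"
  by (auto simp: wf_tm_def transducer_tm_def split: prod.split)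

text \<open>The input is split at the head: \<open>L\<close> is the part left of the head in reversed order, and the
  head scans the first symbol of \<open>R\<close>.\<close>

definition transducer_config ::
    "'q :: finite \<Rightarrow> 'a list \<Rightarrow> 'a list \<Rightarrow> 'a list \<Rightarrow> nat \<times> 'a tape list" where
  "transducer_config q L R out =
     (to_nat q, [(word_cells (rev L @ R), int (length L)), (word_cells out, int (length out))])"

text \<open>An upper bound on the number of steps, so that bounds add up along a chain of runs and
  may be rounded up at its end.\<close>

definition reach :: "'a tm \<Rightarrow> nat \<Rightarrow> nat \<times> 'a tape list \<Rightarrow> nat \<times> 'a tape list \<Rightarrow> bool" where
  "reach M n c c' \<longleftrightarrow> (\<exists>k\<le>n. (tm_step M ^^ k) c = c')"

lemma reach_refl: "reach M n c c"
  unfolding reach_def by (rule exI[of _ 0]) simp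

lemma reach_trans [trans]: "reach M m a b \<Longrightarrow> reach M n b c \<Longrightarrow> reach M (m + n) a c"
  unfolding reach_def
  by (metis (no_types, opaque_lifting) add.commute add_mono comp_apply funpow_add)

lemma reach_mono: "reach M m a b \<Longrightarrow> m \<le> n \<Longrightarrow> reach M n a b"
  unfolding reach_def using le_trans by blast

lemma reach_step: "tm_step M c = c' \<Longrightarrow> reach M 1 c c'"
  unfolding reach_def by (intro exI[of _ 1]) simp

lemma word_cells_append: "(word_cells x)(int (length x) := Some a) = word_cells (x @ [a])"
  by (auto simp: word_cells_def fun_eq_iff nth_append)

lemma word_cells_end [simp]: "word_cells x (int (length x)) = None"
  by (simp add: word_cells_def)

lemma word_cells_at_head [simp]:
  "word_cells (rev L @ R) (int (length L)) = (case R of [] \<Rightarrow> None | c # _ \<Rightarrow> Some c)"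
  by (auto simp: word_cells_def nth_append split: list.split)

text \<open>The new input head stays an integer because splitting the input at it depends on the
  direction of the move; the next lemmas do this for each direction.\<close>

lemma tm_step_transducer:
  assumes "q \<noteq> h" and "\<delta> q (case R of [] \<Rightarrow> None | c # _ \<Rightarrow> Some c) = (q', a, mv)"
  shows "tm_step (transducer_tm \<delta> q0 h) (transducer_config q L R out) =
    (to_nat q', [(word_cells (rev L @ R), move_head mv (int (length L))),
                 (word_cells (out @ emit a), int (length (out @ emit a)))])"
  using assms
  by (cases a)
     (auto simp: tm_step_def transducer_tm_def transducer_config_def read_tape_def act_tape_def
        word_cells_append fun_upd_idem)

context
  fixes \<delta> :: "'q :: finite \<Rightarrow> 'a option \<Rightarrow> 'q \<times> 'a option \<times> move" and q0 h :: 'q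
begin

abbreviation runs :: "nat \<Rightarrow> nat \<times> 'a tape list \<Rightarrow> nat \<times> 'a tape list \<Rightarrow> bool" where
  "runs \<equiv> reach (transducer_tm \<delta> q0 h)"

lemma runs_stay:
  assumes "q \<noteq> h" and "\<delta> q (case R of [] \<Rightarrow> None | c # _ \<Rightarrow> Some c) = (q', a, Stay)"
  shows "runs 1 (transducer_config q L R out) (transducer_config q' L R (out @ emit a))"
  using tm_step_transducer[of q h \<delta> R q' a Stay, OF assms] by (intro reach_step) (simp add: transducer_config_def)

lemma runs_right:
  assumes "q \<noteq> h" and "\<delta> q (Some c) = (q', a, MoveRight)"
  shows "runs 1 (transducer_config q L (c # R) out) (transducer_config q' (c # L) R (out @ emit a))"
  using tm_step_transducer[of q h \<delta> "c # R" q' a MoveRight] assms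
  by (intro reach_step) (simp add: transducer_config_def add.commute)

lemma runs_left:
  assumes "q \<noteq> h" and "\<delta> q (Some c) = (q', a, MoveLeft)"
  shows "runs 1 (transducer_config q (b # L) (c # R) out)
                (transducer_config q' L (b # c # R) (out @ emit a))"
  using tm_step_transducer[of q h \<delta> "c # R" q' a MoveLeft q0 "b # L"] assms
  by (intro reach_step) (simp add: transducer_config_def)

lemma runs_copy:
  assumes "q \<noteq> h" and "\<And>c. c \<in> set w \<Longrightarrow> \<delta> q (Some c) = (q, Some c, MoveRight)"
  shows "runs (length w) (transducer_config q L (w @ R) out)
                         (transducer_config q (rev w @ L) R (out @ w))"
  using assms(2)
proof (induction w arbitrary: L out)
  case (Cons c w)
  have "runs 1 (transducer_config q L (c # w @ R) out)
               (transducer_config q (c # L) (w @ R) (out @ [c]))"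
    using runs_right[OF assms(1), of c q "Some c"] Cons.prems by simp
  from reach_trans[OF this Cons.IH] Cons.prems show ?case by simp
qed (simp add: reach_refl)

lemma runs_skip:
  assumes "q \<noteq> h" and "\<And>c. c \<in> set w \<Longrightarrow> \<delta> q (Some c) = (q, None, MoveRight)"
  shows "runs (length w) (transducer_config q L (w @ R) out) (transducer_config q (rev w @ L) R out)"
  using assms(2)
proof (induction w arbitrary: L)
  case (Cons c w)
  have "runs 1 (transducer_config q L (c # w @ R) out) (transducer_config q (c # L) (w @ R) out)"
    using runs_right[OF assms(1), of c q None _ _ out] Cons.prems by simp
  from reach_trans[OF this Cons.IH] Cons.prems show ?case by simp
qed (simp add: reach_refl)

text \<open>The head crosses \<open>w\<close> leftwards and stops on \<open>b\<close> before
  reacting to it. The induction takes \<open>w\<close> from its right end, the end met first;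
  \<open>q\<close>, \<open>c\<close> and \<open>a\<close> vary because only the first step may start
  outside \<open>r\<close> and emit a symbol.\<close>

lemma runs_rewind:
  assumes "q \<noteq> h" and "\<delta> q (Some c) = (r, a, MoveLeft)"
    and "r \<noteq> h" and "\<And>c. c \<in> set w \<Longrightarrow> \<delta> r (Some c) = (r, None, MoveLeft)"
  shows "runs (length w + 1) (transducer_config q (rev w @ b # L) (c # R) out)
           (transducer_config r L (b # w @ c # R) (out @ emit a))"
  using assms
proof (induction w arbitrary: q c a R out rule: rev_induct)
  case Nil
  then show ?case using runs_left[of q c r a b L R out] by simp
next
  case (snoc x w)
  have "runs 1 (transducer_config q (x # rev w @ b # L) (c # R) out)
               (transducer_config r (rev w @ b # L) (x # c # R) (out @ emit a))"
    using runs_left snoc.prems by simp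
  from reach_trans[OF this snoc.IH[of r x None]] snoc.prems show ?case by simp
qed

end

text \<open>A halting configuration is a fixed point, so a run of at most \<open>n\<close> steps can
  be prolonged to exactly \<open>n\<close>.\<close>

lemma tm_outputs_within_transducer:
  assumes "reach (transducer_tm \<delta> q0 h) n (transducer_config q0 [] x []) (transducer_config h L R y)"
  shows "tm_outputs_within (transducer_tm \<delta> q0 h) x y n"
proof -
  let ?M = "transducer_tm \<delta> q0 h"
  obtain k where k: "k \<le> n" "(tm_step ?M ^^ k) (transducer_config q0 [] x []) = transducer_config h L R y"
    using assms unfolding reach_def by blast
  have init: "tm_init ?M x = transducer_config q0 [] x []"
    by (simp add: tm_init_def transducer_config_def transducer_tm_def)
  have "tm_step ?M (transducer_config h L R y) = transducer_config h L R y"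
    by (simp add: tm_step_def transducer_config_def transducer_tm_def)
  then have "(tm_step ?M ^^ j) (transducer_config h L R y) = transducer_config h L R y" for j
    by (induction j) simp_all
  then have "(tm_step ?M ^^ n) (tm_init ?M x) = transducer_config h L R y"
    using k funpow_add[of "n - k" k "tm_step ?M"] by (simp add: init)
  then show ?thesis
    by (simp add: tm_outputs_within_def transducer_config_def transducer_tm_def)
qed

section \<open>The reduction as a two-way transducer\<close>

text \<open>The order is that of the output: both old state lists, the fresh states in a first pass
  over the edges, a rewind, the new edges in a second pass, then initial state and threshold. In the
  second pass the \<open>In\<close> phases write the edge into a fresh state and the
  \<open>Out\<close> phases the edge out of it.\<close>

datatype phase =
    States1 | States2 | EdgeSource | EdgeTarget | EdgeWeight | RewindEdges
  | InSource | RewindIn | InMidSource | InMidTarget | InWeight | InDigits | InEnd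
  | RewindOut | OutMidSource | OutMidTarget | RewindTarget | OutTarget | OutWeight | OutDigits | OutEnd
  | Initial | Threshold | Halted

instance phase :: finite
proof
  have "(UNIV :: phase set) =
    {States1, States2, EdgeSource, EdgeTarget, EdgeWeight, RewindEdges,
     InSource, RewindIn, InMidSource, InMidTarget, InWeight, InDigits, InEnd,
     RewindOut, OutMidSource, OutMidTarget, RewindTarget, OutTarget, OutWeight, OutDigits, OutEnd,
     Initial, Threshold, Halted}"
    using phase.exhaust by blast
  then show "finite (UNIV :: phase set)"
    by (metis finite.simps)
qed

definition pad :: "bool list \<Rightarrow> bool list" where
  "pad u = concat (map (\<lambda>b. [True, b]) u)"

definition mid :: "bool list \<times> bool list \<Rightarrow> bool list" where
  "mid e = pad (fst e) @ False # pad (snd e)"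

lemma pad_simps [simp]: "pad [] = []" "pad (b # u) = True # b # pad u"
  by (simp_all add: pad_def)

lemma inj_pad: "inj pad"
proof (rule injI)
  show "u = v" if "pad u = pad v" for u v
    using that
  proof (induction u arbitrary: v)
    case Nil
    then show ?case by (cases v) simp_all
  next
    case (Cons b u)
    then show ?case by (cases v) simp_all
  qed
qed

text \<open>A padded word has \<open>True\<close> wherever a pair of bits starts, so the first
  \<open>False\<close> in such a place is the joint and shows where \<open>pad u\<close>
  ends.\<close>

lemma pad_append_False_inject: "pad u @ False # x = pad v @ False # y \<longleftrightarrow> u = v \<and> x = y"
proof (induction u arbitrary: v)
  case Nil
  then show ?case by (cases v) simp_all
next
  case (Cons b u)
  then show ?case by (cases v) auto
qed

lemma inj_mid: "inj mid"
  using inj_pad by (auto intro!: injI simp: mid_def pad_append_False_inject inj_eq prod_eq_iff)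

lemma pad_neq_mid: "pad u \<noteq> mid e"
proof -
  have "pad u \<noteq> pad v @ False # x" for v x
  proof (induction u arbitrary: v)
    case Nil
    then show ?case by (cases v) simp_all
  next
    case (Cons b u)
    then show ?case by (cases v) simp_all
  qed
  then show ?thesis by (simp add: mid_def)
qed

text \<open>Bits scanned in a phase of \<open>padding\<close> are intercepted by
  \<open>reduction_step\<close>, so for those phases only separators reach these clauses. Doubling a
  weight appends a zero digit, except for weight zero, which its first digit reveals.\<close>

fun phase_step :: "phase \<Rightarrow> symbol \<Rightarrow> phase \<times> symbol option \<times> move" where
  "phase_step States1 a =
     (if a = Bar then (States2, Some a, MoveRight) else (States1, Some a, MoveRight))"
| "phase_step States2 a =
     (if a = Bar then (EdgeSource, None, MoveRight) else (States2, Some a, MoveRight))"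
| "phase_step EdgeSource a =
     (if a = Bar then (RewindEdges, Some Bar, MoveLeft) else (EdgeTarget, Some (Bit False), MoveRight))"
| "phase_step EdgeTarget a = (EdgeWeight, Some Semicolon, MoveRight)"
| "phase_step EdgeWeight a = (if a = Semicolon then EdgeSource else EdgeWeight, None, MoveRight)"
| "phase_step RewindEdges a =
     (if a = Bar then (InSource, None, MoveRight) else (RewindEdges, None, MoveLeft))"
| "phase_step InSource a =
     (if a = Bar then (Initial, Some Bar, MoveRight) else (RewindIn, Some Comma, MoveLeft))"
| "phase_step RewindIn a =
     (if a = Semicolon \<or> a = Bar then (InMidSource, None, MoveRight) else (RewindIn, None, MoveLeft))"
| "phase_step InMidSource a = (InMidTarget, Some (Bit False), MoveRight)"
| "phase_step InMidTarget a = (InWeight, Some Comma, MoveRight)"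
| "phase_step InWeight a =
     (if a = Minus then InWeight else if a = Bit False then InEnd else InDigits, Some a, MoveRight)"
| "phase_step InDigits a =
     (if a = Semicolon then (InEnd, Some (Bit False), Stay) else (InDigits, Some a, MoveRight))"
| "phase_step InEnd a = (RewindOut, Some Semicolon, MoveLeft)"
| "phase_step RewindOut a =
     (if a = Semicolon \<or> a = Bar then (OutMidSource, None, MoveRight) else (RewindOut, None, MoveLeft))"
| "phase_step OutMidSource a = (OutMidTarget, Some (Bit False), MoveRight)"
| "phase_step OutMidTarget a = (RewindTarget, Some Comma, MoveLeft)"
| "phase_step RewindTarget a =
     (if a = Comma then (OutTarget, None, MoveRight) else (RewindTarget, None, MoveLeft))"
| "phase_step OutTarget a = (OutWeight, Some Comma, MoveRight)"
| "phase_step OutWeight a =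
     (if a = Minus then (OutDigits, None, MoveRight)
      else if a = Bit False then (OutEnd, Some a, MoveRight)
      else (OutDigits, Some Minus, Stay))"
| "phase_step OutDigits a =
     (if a = Semicolon then (OutEnd, Some (Bit False), Stay) else (OutDigits, Some a, MoveRight))"
| "phase_step OutEnd a = (InSource, Some Semicolon, MoveRight)"
| "phase_step Initial a = (Threshold, Some Bar, MoveRight)"
| "phase_step Threshold a = (Threshold, Some a, MoveRight)"
| "phase_step Halted a = (Halted, None, Stay)"

definition padding :: "phase set" where
  "padding = {States1, States2, EdgeSource, EdgeTarget, InSource, InMidSource, InMidTarget,
     OutMidSource, OutMidTarget, OutTarget, Initial}"

text \<open>The flag records that the bit \<open>1\<close> preceding the scanned bit in the padding has been written.\<close>

definition reduction_step ::
    "phase \<times> bool \<Rightarrow> symbol option \<Rightarrow> (phase \<times> bool) \<times> symbol option \<times> move" where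
  "reduction_step q a = (case (q, a) of
     ((p, _), None) \<Rightarrow> ((Halted, False), None, Stay)
   | ((p, True), Some c) \<Rightarrow> ((p, False), Some c, MoveRight)
   | ((p, False), Some c) \<Rightarrow>
       (if p \<in> padding \<and> c \<in> range Bit then ((p, True), Some (Bit True), Stay)
        else case phase_step p c of (p', out, mv) \<Rightarrow> ((p', False), out, mv)))"

definition reduction_tm :: "symbol tm" where
  "reduction_tm = transducer_tm reduction_step (States1, False) (Halted, False)"

abbreviation config :: "phase \<Rightarrow> symbol list \<Rightarrow> symbol list \<Rightarrow> symbol list \<Rightarrow> nat \<times> symbol tape list" where
  "config p L R out \<equiv> transducer_config (p, False) L R out"

abbreviation runs_within :: "nat \<Rightarrow> nat \<times> symbol tape list \<Rightarrow> nat \<times> symbol tape list \<Rightarrow> bool" where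
  "runs_within \<equiv> reach reduction_tm"

section \<open>Runs within one phase\<close>

lemma reduction_step_simps:
  assumes "p \<notin> padding \<or> c \<notin> range Bit"
  shows "reduction_step (p, False) (Some c) = (case phase_step p c of (p', a, mv) \<Rightarrow> ((p', False), a, mv))"
  using assms by (auto simp: reduction_step_def)

lemma runs_right_phase:
  assumes "p \<noteq> Halted" "p \<notin> padding \<or> c \<notin> range Bit" "phase_step p c = (p', a, MoveRight)"
  shows "runs_within 1 (config p L (c # R) out) (config p' (c # L) R (out @ emit a))"
  unfolding reduction_tm_def using assms by (intro runs_right) (auto simp: reduction_step_simps)

lemma runs_stay_phase:
  assumes "p \<noteq> Halted" "p \<notin> padding \<or> c \<notin> range Bit" "phase_step p c = (p', a, Stay)"
  shows "runs_within 1 (config p L (c # R) out) (config p' L (c # R) (out @ emit a))"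
  unfolding reduction_tm_def using assms by (intro runs_stay) (auto simp: reduction_step_simps)

lemma runs_rewind_phase:
  assumes "p \<noteq> Halted" "p \<notin> padding \<or> c \<notin> range Bit" "phase_step p c = (r, a, MoveLeft)"
    and "r \<noteq> Halted" "r \<notin> padding" "\<And>x. x \<in> set w \<Longrightarrow> phase_step r x = (r, None, MoveLeft)"
  shows "runs_within (length w + 1) (config p (rev w @ b # L) (c # R) out)
           (config r L (b # w @ c # R) (out @ emit a))"
  unfolding reduction_tm_def using assms by (intro runs_rewind) (auto simp: reduction_step_simps)

lemma runs_copy_phase:
  assumes "p \<noteq> Halted" "p \<notin> padding" "\<And>x. x \<in> set w \<Longrightarrow> phase_step p x = (p, Some x, MoveRight)"
  shows "runs_within (length w) (config p L (w @ R) out) (config p (rev w @ L) R (out @ w))"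
  unfolding reduction_tm_def using assms by (intro runs_copy) (auto simp: reduction_step_simps)

lemma runs_skip_phase:
  assumes "p \<noteq> Halted" "p \<notin> padding" "\<And>x. x \<in> set w \<Longrightarrow> phase_step p x = (p, None, MoveRight)"
  shows "runs_within (length w) (config p L (w @ R) out) (config p (rev w @ L) R out)"
  unfolding reduction_tm_def using assms by (intro runs_skip) (auto simp: reduction_step_simps)

text \<open>Two steps per bit: the extra \<open>True\<close> is written without moving, then the bit
  itself is copied.\<close>

lemma runs_pad:
  assumes "p \<in> padding"
  shows "runs_within (2 * length u) (config p L (enc_state u @ R) out)
           (config p (rev (enc_state u) @ L) R (out @ enc_state (pad u)))"
proof (induction u arbitrary: L out)
  case (Cons b u)
  have p: "p \<noteq> Halted" using assms by (auto simp: padding_def)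
  let ?R = "enc_state u @ R"
  have "runs_within 1 (config p L (Bit b # ?R) out)
          (transducer_config (p, True) L (Bit b # ?R) (out @ emit (Some (Bit True))))"
    unfolding reduction_tm_def using assms p by (intro runs_stay) (auto simp: reduction_step_def)
  also have "runs_within 1 \<dots>
      (config p (Bit b # L) ?R ((out @ emit (Some (Bit True))) @ emit (Some (Bit b))))"
    unfolding reduction_tm_def using p by (intro runs_right) (auto simp: reduction_step_def)
  also note Cons.IH
  finally show ?case by (simp add: enc_state_def)
qed (simp add: enc_state_def reach_refl)

lemma runs_pad_right:
  assumes "p \<in> padding" "c \<notin> range Bit" "phase_step p c = (p', a, MoveRight)"
  shows "runs_within (2 * length u + 1) (config p L (enc_state u @ c # R) out)
           (config p' (c # rev (enc_state u) @ L) R (out @ enc_state (pad u) @ emit a))"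
proof -
  have "p \<noteq> Halted" using assms(1) by (auto simp: padding_def)
  from reach_trans[OF runs_pad[OF assms(1)] runs_right_phase[OF this _ assms(3)]] assms(2)
  show ?thesis by simp
qed

text \<open>For a name that is needed again: after writing it the head returns to the symbol in
  front of it, which adds a third step per bit.\<close>

lemma runs_pad_rewind:
  assumes "p \<in> padding" "c \<notin> range Bit" "phase_step p c = (r, a, MoveLeft)"
    and "r \<noteq> Halted" "r \<notin> padding" "\<And>x. phase_step r (Bit x) = (r, None, MoveLeft)"
  shows "runs_within (3 * length u + 1) (config p (b # L) (enc_state u @ c # R) out)
           (config r L (b # enc_state u @ c # R) (out @ enc_state (pad u) @ emit a))"
proof -
  have "p \<noteq> Halted" using assms(1) by (auto simp: padding_def)
  then have "runs_within (length (enc_state u) + 1)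
      (config p (rev (enc_state u) @ b # L) (c # R) (out @ enc_state (pad u)))
      (config r L (b # enc_state u @ c # R) ((out @ enc_state (pad u)) @ emit a))"
    using assms by (intro runs_rewind_phase) (auto simp: enc_state_def)
  from reach_trans[OF runs_pad[OF assms(1)] this] show ?thesis
    by (simp add: enc_state_def)
qed

section \<open>Doubling and negating binary weights\<close>

lemma binary_double: "n \<noteq> 0 \<Longrightarrow> binary (2 * n) = binary n @ [False]"
  by (subst binary.simps) simp

text \<open>Without leading zeros, the machine can tell zero from a positive number by its first
  digit.\<close>

lemma binary_hd: "n \<noteq> 0 \<Longrightarrow> \<exists>u. binary n = True # u"
proof (induction n rule: binary.induct)
  case (1 n)
  then show ?case
    by (cases "n < 2"; subst binary.simps) auto
qed

text \<open>These are the shapes distinguished by the first symbol of a weight. Zero stands apart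
  since neither doubling nor negation changes its code.\<close>

lemma enc_int_cases:
  obtains (zero) "z = 0" "enc_int z = [Bit False]" "enc_int (2 * z) = [Bit False]"
      "enc_int (- (2 * z)) = [Bit False]"
  | (pos) u where "enc_int z = Bit True # enc_state u"
      "enc_int (2 * z) = Bit True # enc_state u @ [Bit False]"
      "enc_int (- (2 * z)) = Minus # Bit True # enc_state u @ [Bit False]"
  | (neg) u where "enc_int z = Minus # Bit True # enc_state u"
      "enc_int (2 * z) = Minus # Bit True # enc_state u @ [Bit False]"
      "enc_int (- (2 * z)) = Bit True # enc_state u @ [Bit False]"
proof (cases "z = 0")
  case True
  have "binary 0 = [False]" by (simp add: binary.simps)
  then show thesis using True zero by (simp add: enc_int_def)
next
  case False
  then obtain u where u: "binary (nat \<bar>z\<bar>) = True # u"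
    using binary_hd by fastforce
  have "nat \<bar>2 * z\<bar> = 2 * nat \<bar>z\<bar>" by (simp add: nat_mult_distrib abs_mult)
  then have "binary (nat \<bar>2 * z\<bar>) = True # u @ [False]"
    using False u by (simp add: binary_double)
  then show thesis
    using False u pos[of u] neg[of u] by (cases "z < 0") (auto simp: enc_int_def enc_state_def)
qed

lemma separators_not_in_enc_int: "c \<in> {Comma, Semicolon, Bar} \<Longrightarrow> c \<notin> set (enc_int z)"
  by (auto simp: enc_int_def)

section \<open>Passes over lists of states and edges\<close>

text \<open>Runs linear in each entry combine to a run linear in the list. The invariant
  \<open>P\<close> speaks of the tape left of the head, as rewinding needs a separator there; passes
  without rewinding take it trivial.\<close>

lemma runs_blocks:
  assumes "\<And>x L R out. x \<in> set xs \<Longrightarrow> P L \<Longrightarrow>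
      runs_within (k * length (f x)) (config p L (f x @ R) out) (config p (rev (f x) @ L) R (out @ g x))"
    and "\<And>x L. x \<in> set xs \<Longrightarrow> P L \<Longrightarrow> P (rev (f x) @ L)"
    and "P L"
  shows "runs_within (k * length (concat (map f xs))) (config p L (concat (map f xs) @ R) out)
           (config p (rev (concat (map f xs)) @ L) R (out @ concat (map g xs)))"
  using assms
proof (induction xs arbitrary: L out)
  case (Cons x xs)
  have "runs_within (k * length (f x)) (config p L (f x @ concat (map f xs) @ R) out)
          (config p (rev (f x) @ L) (concat (map f xs) @ R) (out @ g x))"
    using Cons.prems by simp
  also have "runs_within (k * length (concat (map f xs))) \<dots>
      (config p (rev (concat (map f xs)) @ rev (f x) @ L) R ((out @ g x) @ concat (map g xs)))"
    using Cons.prems by (intro Cons.IH) simp_all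
  finally show ?case by (simp add: algebra_simps)
qed (simp add: reach_refl)

lemma runs_state_block:
  assumes "p \<in> {States1, States2}"
  shows "runs_within (2 * length (enc_state u @ [Semicolon]))
           (config p L ((enc_state u @ [Semicolon]) @ R) out)
           (config p (rev (enc_state u @ [Semicolon]) @ L) R (out @ enc_state (pad u) @ [Semicolon]))"
proof -
  have "runs_within (2 * length u + 1) (config p L (enc_state u @ Semicolon # R) out)
          (config p (Semicolon # rev (enc_state u) @ L) R
             (out @ enc_state (pad u) @ emit (Some Semicolon)))"
    using assms by (intro runs_pad_right) (auto simp: padding_def)
  then show ?thesis
    by (auto simp: enc_state_def intro: reach_mono)
qed

lemma enc_state_mid: "enc_state (mid (u, v)) = enc_state (pad u) @ Bit False # enc_state (pad v)"
  by (simp add: enc_state_def mid_def)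

lemma length_enc_state [simp]: "length (enc_state u) = length u"
  by (simp add: enc_state_def)

text \<open>The first comma becomes the joining zero, the second one the closing semicolon, and the
  weight is skipped silently.\<close>

lemma runs_edge_state_block:
  "runs_within (2 * length (enc_edge (u, v, z) @ [Semicolon]))
     (config EdgeSource L ((enc_edge (u, v, z) @ [Semicolon]) @ R) out)
     (config EdgeSource (rev (enc_edge (u, v, z) @ [Semicolon]) @ L) R
        (out @ enc_state (mid (u, v)) @ [Semicolon]))"
proof -
  have "runs_within (2 * length u + 1)
      (config EdgeSource L (enc_state u @ Comma # enc_state v @ Comma # enc_int z @ Semicolon # R) out)
      (config EdgeTarget (Comma # rev (enc_state u) @ L)
        (enc_state v @ Comma # enc_int z @ Semicolon # R)
        (out @ enc_state (pad u) @ emit (Some (Bit False))))"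
    by (rule runs_pad_right) (auto simp: padding_def)
  also have "runs_within (2 * length v + 1) \<dots>
      (config EdgeWeight (Comma # rev (enc_state v) @ Comma # rev (enc_state u) @ L)
        (enc_int z @ Semicolon # R)
        ((out @ enc_state (pad u) @ emit (Some (Bit False))) @ enc_state (pad v) @ emit (Some Semicolon)))"
    by (rule runs_pad_right) (auto simp: padding_def)
  also have "runs_within (length (enc_int z)) \<dots>
      (config EdgeWeight (rev (enc_int z) @ Comma # rev (enc_state v) @ Comma # rev (enc_state u) @ L)
        (Semicolon # R)
        ((out @ enc_state (pad u) @ emit (Some (Bit False))) @ enc_state (pad v) @ emit (Some Semicolon)))"
    using separators_not_in_enc_int[of Semicolon z]
    by (intro runs_skip_phase) (auto simp: padding_def)
  also have "runs_within 1 \<dots>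
      (config EdgeSource
        (Semicolon # rev (enc_int z) @ Comma # rev (enc_state v) @ Comma # rev (enc_state u) @ L) R
        (((out @ enc_state (pad u) @ emit (Some (Bit False))) @ enc_state (pad v) @ emit (Some Semicolon))
          @ emit None))"
    by (rule runs_right_phase) (auto simp: padding_def)
  finally have "runs_within (2 * length (enc_edge (u, v, z) @ [Semicolon]))
      (config EdgeSource L (enc_state u @ Comma # enc_state v @ Comma # enc_int z @ Semicolon # R) out)
      (config EdgeSource
        (Semicolon # rev (enc_int z) @ Comma # rev (enc_state v) @ Comma # rev (enc_state u) @ L) R
        (((out @ enc_state (pad u) @ emit (Some (Bit False))) @ enc_state (pad v) @ emit (Some Semicolon))
          @ emit None))"
    by (rule reach_mono) (simp add: enc_edge_def)
  then show ?thesis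
    by (simp add: enc_edge_def enc_state_mid)
qed

text \<open>The appended zero is written while the head rests on the semicolon, which the next phase
  still has to see.\<close>

lemma runs_digits:
  assumes "(p, p') \<in> {(InDigits, InEnd), (OutDigits, OutEnd)}"
  shows "runs_within (length u + 1) (config p L (enc_state u @ Semicolon # R) out)
           (config p' (rev (enc_state u) @ L) (Semicolon # R) (out @ enc_state u @ [Bit False]))"
proof -
  have "runs_within (length (enc_state u)) (config p L (enc_state u @ Semicolon # R) out)
          (config p (rev (enc_state u) @ L) (Semicolon # R) (out @ enc_state u))"
    using assms by (intro runs_copy_phase) (auto simp: padding_def enc_state_def)
  also have "runs_within 1 \<dots>
      (config p' (rev (enc_state u) @ L) (Semicolon # R) ((out @ enc_state u) @ emit (Some (Bit False))))"
    using assms by (intro runs_stay_phase) auto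
  finally show ?thesis by simp
qed

lemma runs_in_weight:
  "runs_within (length (enc_int z) + 1) (config InWeight L (enc_int z @ Semicolon # R) out)
     (config InEnd (rev (enc_int z) @ L) (Semicolon # R) (out @ enc_int (2 * z)))"
proof -
  have right: "runs_within 1 (config InWeight L (c # R) out) (config p (c # L) R (out @ [c]))"
    if "phase_step InWeight c = (p, Some c, MoveRight)" for c p L R out
    using runs_right_phase[OF _ _ that] by (simp add: padding_def)
  have digits: "runs_within (length u + 2) (config InWeight L (Bit True # enc_state u @ Semicolon # R) out)
      (config InEnd (rev (enc_state u) @ Bit True # L) (Semicolon # R)
        (out @ Bit True # enc_state u @ [Bit False]))" for u L out
    using reach_trans[OF right[of "Bit True" InDigits] runs_digits[of InDigits InEnd u]] by simp
  show ?thesis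
  proof (cases z rule: enc_int_cases)
    case zero
    then show ?thesis using reach_mono[OF right[of "Bit False" InEnd]] by simp
  next
    case (pos u)
    then show ?thesis using digits by simp
  next
    case (neg u)
    then show ?thesis using reach_trans[OF right[of Minus InWeight] digits] by simp
  qed
qed

text \<open>A minus sign is dropped, and a new one is written before a leading 1 without moving,
  while zero stays unsigned. The two extra steps pay for the new sign and the appended
  digit.\<close>

lemma runs_out_weight:
  "runs_within (length (enc_int z) + 2) (config OutWeight L (enc_int z @ Semicolon # R) out)
     (config OutEnd (rev (enc_int z) @ L) (Semicolon # R) (out @ enc_int (- (2 * z))))"
proof (cases z rule: enc_int_cases)
  case zero
  have "runs_within 1 (config OutWeight L (Bit False # Semicolon # R) out)
          (config OutEnd (Bit False # L) (Semicolon # R) (out @ emit (Some (Bit False))))"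
    by (rule runs_right_phase) (auto simp: padding_def)
  from reach_mono[OF this] show ?thesis using zero by simp
next
  case (pos u)
  have "runs_within 1 (config OutWeight L (Bit True # enc_state u @ Semicolon # R) out)
          (config OutDigits L (Bit True # enc_state u @ Semicolon # R) (out @ emit (Some Minus)))"
    by (rule runs_stay_phase) (auto simp: padding_def)
  \<comment> \<open>Writing the sign did not consume the leading 1, so it is copied with the
    digits.\<close>
  from reach_trans[OF this, of "length (True # u) + 1"]
       runs_digits[of OutDigits OutEnd "True # u" L R "out @ [Minus]"]
  show ?thesis using pos by (simp add: enc_state_def)
next
  case (neg u)
  have "runs_within 1 (config OutWeight L (Minus # Bit True # enc_state u @ Semicolon # R) out)
          (config OutDigits (Minus # L) (Bit True # enc_state u @ Semicolon # R) (out @ emit None))"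
    by (rule runs_right_phase) (auto simp: padding_def)
  from reach_trans[OF this, of "length (True # u) + 1"]
       runs_digits[of OutDigits OutEnd "True # u" "Minus # L" R out]
  have "runs_within (Suc (Suc (Suc (length u)))) (config OutWeight L (Minus # Bit True # enc_state u @ Semicolon # R) out)
      (config OutEnd (rev (enc_state u) @ Bit True # Minus # L) (Semicolon # R)
        (out @ Bit True # enc_state u @ [Bit False]))"
    by (simp add: enc_state_def)
  from reach_mono[OF this, of "Suc (Suc (Suc (Suc (length u))))"] show ?thesis using neg by simp
qed

fun split_edge :: "bool list \<times> bool list \<times> int \<Rightarrow> (bool list \<times> bool list \<times> int) list" where
  "split_edge (u, v, z) = [(pad u, mid (u, v), 2 * z), (mid (u, v), pad v, - (2 * z))]"

text \<open>\<open>b\<close> is the separator in front of the edge, a bar for the first edge and a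
  semicolon later. It stops the two rewinds to the start of the edge, since neither symbol occurs
  inside before the final semicolon.\<close>

lemma runs_edge_block:
  assumes "b \<in> {Semicolon, Bar}"
  shows "runs_within (10 * length (enc_edge (u, v, z) @ [Semicolon]))
     (config InSource (b # L) ((enc_edge (u, v, z) @ [Semicolon]) @ R) out)
     (config InSource (rev (enc_edge (u, v, z) @ [Semicolon]) @ b # L) R
        (out @ concat (map (\<lambda>e. enc_edge e @ [Semicolon]) (split_edge (u, v, z)))))"
proof -
  let ?U = "enc_state u" and ?V = "enc_state v" and ?Z = "enc_int z"
  let ?U' = "enc_state (pad u)" and ?V' = "enc_state (pad v)"
  let ?w = "?U @ Comma # ?V @ Comma # ?Z"
  have b: "b \<notin> range Bit" using assms by auto
  have not_sep: "x \<noteq> Semicolon" "x \<noteq> Bar" if "x \<in> set ?w" for x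
    using that separators_not_in_enc_int[of Semicolon z] separators_not_in_enc_int[of Bar z]
    by (auto simp: enc_state_def)
  define out1 where "out1 = out @ ?U' @ emit (Some Comma)"
  define out2 where "out2 = out1 @ ?U' @ emit (Some (Bit False))"
  define out3 where "out3 = out2 @ ?V' @ emit (Some Comma)"
  define out4 where "out4 = (out3 @ enc_int (2 * z)) @ emit (Some Semicolon)"
  define out5 where "out5 = out4 @ ?U' @ emit (Some (Bit False))"
  define out6 where "out6 = out5 @ ?V' @ emit (Some Comma)"
  define out7 where "out7 = out6 @ ?V' @ emit (Some Comma)"
  have "runs_within (3 * length u + 1)
      (config InSource (b # L) (?U @ Comma # ?V @ Comma # ?Z @ Semicolon # R) out)
      (config RewindIn L (b # ?U @ Comma # ?V @ Comma # ?Z @ Semicolon # R) out1)"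
    unfolding out1_def by (rule runs_pad_rewind) (auto simp: padding_def)
  also have "runs_within 1 \<dots>
      (config InMidSource (b # L) (?U @ Comma # ?V @ Comma # ?Z @ Semicolon # R) (out1 @ emit None))"
    using assms b by (intro runs_right_phase) auto
  also have "\<dots> = config InMidSource (b # L) (?U @ Comma # ?V @ Comma # ?Z @ Semicolon # R) out1"
    by simp
  also have "runs_within (2 * length u + 1) \<dots>
      (config InMidTarget (Comma # rev ?U @ b # L) (?V @ Comma # ?Z @ Semicolon # R) out2)"
    unfolding out2_def by (rule runs_pad_right) (auto simp: padding_def)
  also have "runs_within (2 * length v + 1) \<dots>
      (config InWeight (Comma # rev ?V @ Comma # rev ?U @ b # L) (?Z @ Semicolon # R) out3)"
    unfolding out3_def by (rule runs_pad_right) (auto simp: padding_def)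
  also have "runs_within (length ?Z + 1) \<dots>
      (config InEnd (rev ?Z @ Comma # rev ?V @ Comma # rev ?U @ b # L) (Semicolon # R)
        (out3 @ enc_int (2 * z)))"
    by (rule runs_in_weight)
  \<comment> \<open>Source, target and weight are regrouped as one reversed word, so that a single
    rewind crosses the whole edge.\<close>
  also have "\<dots> = config InEnd (rev ?w @ b # L) (Semicolon # R) (out3 @ enc_int (2 * z))"
    by simp
  also have "runs_within (length ?w + 1) \<dots> (config RewindOut L (b # ?w @ Semicolon # R) out4)"
    unfolding out4_def using not_sep by (intro runs_rewind_phase) (auto simp: padding_def)
  also have "runs_within 1 \<dots> (config OutMidSource (b # L) (?w @ Semicolon # R) (out4 @ emit None))"
    using assms b by (intro runs_right_phase) auto
  also have "\<dots> = config OutMidSource (b # L) (?U @ Comma # ?V @ Comma # ?Z @ Semicolon # R) out4"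
    by simp
  also have "runs_within (2 * length u + 1) \<dots>
      (config OutMidTarget (Comma # rev ?U @ b # L) (?V @ Comma # ?Z @ Semicolon # R) out5)"
    unfolding out5_def by (rule runs_pad_right) (auto simp: padding_def)
  \<comment> \<open>The target is written twice, as the end of the fresh name and as the endpoint of
    the new edge; this rewind therefore goes back only to the comma before it.\<close>
  also have "runs_within (3 * length v + 1) \<dots>
      (config RewindTarget (rev ?U @ b # L) (Comma # ?V @ Comma # ?Z @ Semicolon # R) out6)"
    unfolding out6_def by (rule runs_pad_rewind) (auto simp: padding_def)
  also have "runs_within 1 \<dots>
      (config OutTarget (Comma # rev ?U @ b # L) (?V @ Comma # ?Z @ Semicolon # R) (out6 @ emit None))"
    by (rule runs_right_phase) (auto simp: padding_def)
  also have "\<dots> = config OutTarget (Comma # rev ?U @ b # L) (?V @ Comma # ?Z @ Semicolon # R) out6"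
    by simp
  also have "runs_within (2 * length v + 1) \<dots>
      (config OutWeight (Comma # rev ?V @ Comma # rev ?U @ b # L) (?Z @ Semicolon # R) out7)"
    unfolding out7_def by (rule runs_pad_right) (auto simp: padding_def)
  also have "runs_within (length ?Z + 2) \<dots>
      (config OutEnd (rev ?Z @ Comma # rev ?V @ Comma # rev ?U @ b # L) (Semicolon # R)
        (out7 @ enc_int (- (2 * z))))"
    by (rule runs_out_weight)
  also have "runs_within 1 \<dots>
      (config InSource (Semicolon # rev ?Z @ Comma # rev ?V @ Comma # rev ?U @ b # L) R
        ((out7 @ enc_int (- (2 * z))) @ emit (Some Semicolon)))"
    by (rule runs_right_phase) (auto simp: padding_def)
  \<comment> \<open>Eight steps per bit of source and target, three per symbol of the weight and 16
    more, which the three separators pay for.\<close>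
  finally have "runs_within (10 * length (enc_edge (u, v, z) @ [Semicolon]))
      (config InSource (b # L) (?U @ Comma # ?V @ Comma # ?Z @ Semicolon # R) out)
      (config InSource (Semicolon # rev ?Z @ Comma # rev ?V @ Comma # rev ?U @ b # L) R
        ((out7 @ enc_int (- (2 * z))) @ emit (Some Semicolon)))"
    by (rule reach_mono) (simp add: enc_edge_def)
  then show ?thesis
    by (simp add: enc_edge_def enc_state_mid out1_def out2_def out3_def out4_def out5_def out6_def out7_def)
qed

section \<open>The complete run and its output\<close>

definition reduced_instance ::
    "bool list list \<Rightarrow> bool list list \<Rightarrow> (bool list \<times> bool list \<times> int) list \<Rightarrow> bool list \<Rightarrow> rat \<Rightarrow> symbol list"
  where
  "reduced_instance l1 l2 es s t =
     enc_list enc_state (map pad l1) @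
     enc_list enc_state (map pad l2 @ map (\<lambda>(u, v, z). mid (u, v)) es) @
     enc_list enc_edge (concat (map split_edge es)) @ enc_state (pad s) @ [Bar] @ enc_rat t"

text \<open>The edge list costs 13 steps per symbol: two for the fresh states, one for the rewind
  and ten for the new edges. Everything else costs at most two per symbol, plus seven steps covered
  by the four bars.\<close>

lemma reduction_tm_outputs:
  assumes x: "x = enc_list enc_state l1 @ enc_list enc_state l2 @ enc_list enc_edge es @
                  enc_state s @ [Bar] @ enc_rat t"
  shows "tm_outputs_within reduction_tm x (reduced_instance l1 l2 es s t) (20 * length x)"
proof -
  define A B E T where
    "A = concat (map (\<lambda>u. enc_state u @ [Semicolon]) l1)" and
    "B = concat (map (\<lambda>u. enc_state u @ [Semicolon]) l2)" and
    "E = concat (map (\<lambda>e. enc_edge e @ [Semicolon]) es)" and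
    "T = enc_rat t"
  define A' B' M E' where
    "A' = concat (map (\<lambda>u. enc_state (pad u) @ [Semicolon]) l1)" and
    "B' = concat (map (\<lambda>u. enc_state (pad u) @ [Semicolon]) l2)" and
    "M = concat (map (\<lambda>(u, v, z). enc_state (mid (u, v)) @ [Semicolon]) es)" and
    "E' = concat (map (\<lambda>e. concat (map (\<lambda>e. enc_edge e @ [Semicolon]) (split_edge e))) es)"
  have x_eq: "x = A @ Bar # B @ Bar # E @ Bar # enc_state s @ Bar # T"
    by (simp add: x enc_list_def A_def B_def E_def T_def)
  \<comment> \<open>The rewind over the edge list must stop at the bar before it and not
    earlier.\<close>
  have "Bar \<notin> set E"
    using separators_not_in_enc_int[of Bar] by (auto simp: E_def enc_edge_def enc_state_def)
  then have no_Bar: "c \<noteq> Bar" if "c \<in> set E" for c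
    using that by blast
  define out1 where "out1 = ([] @ A') @ emit (Some Bar)"
  define out2 where "out2 = ((out1 @ B') @ M) @ emit (Some Bar)"
  define out3 where "out3 = (out2 @ E') @ emit (Some Bar)"
  define out4 where "out4 = out3 @ enc_state (pad s) @ emit (Some Bar)"
  have "runs_within (2 * length A)
      (config States1 [] (A @ Bar # B @ Bar # E @ Bar # enc_state s @ Bar # T) [])
      (config States1 (rev A @ []) (Bar # B @ Bar # E @ Bar # enc_state s @ Bar # T) ([] @ A'))"
    unfolding A_def A'_def by (rule runs_blocks[where P = "\<lambda>_. True"]) (use runs_state_block in auto)
  also have "runs_within 1 \<dots>
      (config States2 (Bar # rev A @ []) (B @ Bar # E @ Bar # enc_state s @ Bar # T) out1)"
    unfolding out1_def by (rule runs_right_phase) auto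
  also have "runs_within (2 * length B) \<dots>
      (config States2 (rev B @ Bar # rev A @ []) (Bar # E @ Bar # enc_state s @ Bar # T) (out1 @ B'))"
    unfolding B_def B'_def by (rule runs_blocks[where P = "\<lambda>_. True"]) (use runs_state_block in auto)
  also have "runs_within 1 \<dots>
      (config EdgeSource (Bar # rev B @ Bar # rev A @ []) (E @ Bar # enc_state s @ Bar # T)
        ((out1 @ B') @ emit None))"
    by (rule runs_right_phase) auto
  also have "\<dots> = config EdgeSource (Bar # rev B @ Bar # rev A) (E @ Bar # enc_state s @ Bar # T)
      (out1 @ B')"
    by simp
  also have "runs_within (2 * length E) \<dots>
      (config EdgeSource (rev E @ Bar # rev B @ Bar # rev A) (Bar # enc_state s @ Bar # T)
        ((out1 @ B') @ M))"
    unfolding E_def M_def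
    by (rule runs_blocks[where P = "\<lambda>_. True"]) (use runs_edge_state_block in auto)
  also have "runs_within (length E + 1) \<dots>
      (config RewindEdges (rev B @ Bar # rev A) (Bar # E @ Bar # enc_state s @ Bar # T) out2)"
    unfolding out2_def using no_Bar by (intro runs_rewind_phase) (auto simp: padding_def)
  also have "runs_within 1 \<dots>
      (config InSource (Bar # rev B @ Bar # rev A) (E @ Bar # enc_state s @ Bar # T) (out2 @ emit None))"
    by (rule runs_right_phase) auto
  also have "\<dots> = config InSource (Bar # rev B @ Bar # rev A) (E @ Bar # enc_state s @ Bar # T) out2"
    by simp
  also have "runs_within (10 * length E) \<dots>
      (config InSource (rev E @ Bar # rev B @ Bar # rev A) (Bar # enc_state s @ Bar # T) (out2 @ E'))"
    unfolding E_def E'_def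
  \<comment> \<open>A separator lies just left of the head: the bar at first, then the semicolon of
    the preceding edge.\<close>
  proof (rule runs_blocks[where P = "\<lambda>L. \<exists>b L'. L = b # L' \<and> b \<in> {Semicolon, Bar}"])
    fix e :: "bool list \<times> bool list \<times> int" and L R out :: "symbol list"
    assume "\<exists>b L'. L = b # L' \<and> b \<in> {Semicolon, Bar}"
    then show "runs_within (10 * length (enc_edge e @ [Semicolon]))
        (config InSource L ((enc_edge e @ [Semicolon]) @ R) out)
        (config InSource (rev (enc_edge e @ [Semicolon]) @ L) R
          (out @ concat (map (\<lambda>e. enc_edge e @ [Semicolon]) (split_edge e))))"
      using runs_edge_block by (cases e) blast
  qed auto
  also have "runs_within 1 \<dots>
      (config Initial (Bar # rev E @ Bar # rev B @ Bar # rev A) (enc_state s @ Bar # T) out3)"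
    unfolding out3_def by (rule runs_right_phase) auto
  also have "runs_within (2 * length s + 1) \<dots>
      (config Threshold (Bar # rev (enc_state s) @ Bar # rev E @ Bar # rev B @ Bar # rev A) (T @ []) out4)"
    unfolding out4_def append_Nil2 by (rule runs_pad_right) (auto simp: padding_def)
  also have "runs_within (length T) \<dots>
      (config Threshold (rev T @ Bar # rev (enc_state s) @ Bar # rev E @ Bar # rev B @ Bar # rev A) []
        (out4 @ T))"
    by (rule runs_copy_phase) (auto simp: padding_def)
  \<comment> \<open>The blank cell after the input sends the control to the halting state.\<close>
  also have "runs_within 1 \<dots>
      (config Halted (rev T @ Bar # rev (enc_state s) @ Bar # rev E @ Bar # rev B @ Bar # rev A) []
        ((out4 @ T) @ emit None))"
    unfolding reduction_tm_def by (rule runs_stay) (auto simp: reduction_step_def)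
  finally have "runs_within (20 * length x) (config States1 [] x [])
      (config Halted (rev T @ Bar # rev (enc_state s) @ Bar # rev E @ Bar # rev B @ Bar # rev A) []
        ((out4 @ T) @ emit None))"
    unfolding x_eq by (rule reach_mono) simp
  then have "tm_outputs_within reduction_tm x ((out4 @ T) @ emit None) (20 * length x)"
    unfolding reduction_tm_def by (rule tm_outputs_within_transducer)
  moreover have "E' = concat (map (\<lambda>e. enc_edge e @ [Semicolon]) (concat (map split_edge es)))"
    unfolding E'_def by (induction es) simp_all
  then have "reduced_instance l1 l2 es s t = (out4 @ T) @ emit None"
    by (simp add: reduced_instance_def enc_list_def out1_def out2_def out3_def out4_def
        A'_def B'_def M_def T_def comp_def case_prod_unfold)
  ultimately show ?thesis by simp
qed

text \<open>Both new lists inherit the order of the input, which is harmless because any order is a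
  valid code; what remains is that nothing is repeated or missing.\<close>

lemma encodes_reduced_instance:
  fixes G :: "bool list game"
  assumes "subdivided_game G pad mid"
    and l1: "distinct l1" "set l1 = states1 G" and l2: "distinct l2" "set l2 = states2 G"
    and es: "distinct es" "set es = {(u, v, weight G (u, v)) | u v. (u, v) \<in> edges G}"
  shows "encodes (reduced_instance l1 l2 es s t) (subdivided_game.subdivision G pad mid) (pad s) t"
proof -
  interpret subdivided_game G pad mid by fact
  let ?l1 = "map pad l1" and ?l2 = "map pad l2 @ map (\<lambda>(u, v, z). mid (u, v)) es"
    and ?es = "concat (map split_edge es)"
  have inj: "inj_on pad S" for S
    using inj_pad by (rule inj_on_subset) simp
  have "distinct ?l1" "set ?l1 = states1 subdivision"
    using l1 inj by (simp_all add: distinct_map subdivision_def)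
  \<comment> \<open>The weight is determined by the endpoints, so dropping it merges no
    entries.\<close>
  moreover have "inj_on (\<lambda>(u, v, z). mid (u, v)) (set es)"
    by (auto simp: es inj_on_def)
  then have "distinct ?l2"
    using l2 es(1) inj by (auto simp: distinct_map)
  moreover have "set ?l2 = states2 subdivision"
    by (force simp: l2 es subdivision_def)
  \<comment> \<open>Every new edge has a fresh endpoint naming the old edge it comes from, so the
    lists for different old edges are disjoint.\<close>
  moreover have "distinct ?es"
  proof (rule distinct_concat)
    have "inj_on split_edge (set es)"
      by (auto simp: inj_on_def)
    then show "distinct (map split_edge es)"
      using es(1) by (simp add: distinct_map)
  qed (auto simp: es)
  moreover have "set ?es = {(x, y, weight subdivision (x, y)) | x y. (x, y) \<in> edges subdivision}"
  proof -
    have "set ?es = (\<Union>(u, v)\<in>edges G. set (split_edge (u, v, weight G (u, v))))"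
      by (force simp: es)
    also have "\<dots> = {(x, y, weight subdivision (x, y)) | x y. (x, y) \<in> edges subdivision}"
    proof -
      have "edges subdivision = (\<Union>(u, v)\<in>edges G. {(pad u, mid (u, v)), (mid (u, v), pad v)})"
        by (auto simp: subdivision_def)
      then show ?thesis by fastforce
    qed
    finally show ?thesis .
  qed
  ultimately show ?thesis
    unfolding encodes_def reduced_instance_def by blast
qed

theorem theorem5:
  "\<exists>(M :: symbol tm) (p :: nat poly). wf_tm M \<and>
     (\<forall>G s t x. is_game G \<and> s \<in> states G \<and> encodes x G s t \<longrightarrow>
        (\<exists>G' s' t' y. tm_outputs_within M x y (poly p (length x)) \<and>
           is_game G' \<and> s' \<in> states G' \<and> encodes y G' s' t' \<and>
           (player1_wins G s (MeanPayoff G t) \<longleftrightarrow> player1_wins G' s' (AvgEnergy G' t'))))"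
proof (rule exI[of _ reduction_tm], rule exI[of _ "[:0, 20:]"], intro conjI allI impI)
  show "wf_tm reduction_tm"
    unfolding reduction_tm_def by (rule wf_transducer_tm)
next
  fix G s t x assume "is_game G \<and> s \<in> states G \<and> encodes x G s t"
  then have game: "is_game G" and s: "s \<in> states G" and "encodes x G s t" by auto
  then obtain l1 l2 es where l: "distinct l1" "set l1 = states1 G" "distinct l2" "set l2 = states2 G"
      "distinct es" "set es = {(u, v, weight G (u, v)) | u v. (u, v) \<in> edges G}"
    and x: "x = enc_list enc_state l1 @ enc_list enc_state l2 @ enc_list enc_edge es @
                enc_state s @ [Bar] @ enc_rat t"
    unfolding encodes_def by blast
  interpret subdivided_game G pad mid
    using game inj_pad inj_mid pad_neq_mid by unfold_locales
  \<comment> \<open>\<open>[:0, 20:]\<close> is the polynomial whose value at \<open>n\<close> is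
    \<open>20 * n\<close>.\<close>
  have "tm_outputs_within reduction_tm x (reduced_instance l1 l2 es s t) (poly [:0, 20:] (length x))"
    using reduction_tm_outputs[OF x] by (simp add: mult.commute)
  moreover have "encodes (reduced_instance l1 l2 es s t) subdivision (pad s) t"
    using encodes_reduced_instance[OF subdivided_game_axioms l] .
  ultimately show "\<exists>G' s' t' y. tm_outputs_within reduction_tm x y (poly [:0, 20:] (length x)) \<and>
      is_game G' \<and> s' \<in> states G' \<and> encodes y G' s' t' \<and>
      (player1_wins G s (MeanPayoff G t) \<longleftrightarrow> player1_wins G' s' (AvgEnergy G' t'))"
    using is_game_subdivision d_in_states_subdivision[OF s] player1_wins_subdivision_iff by blast
qed

end
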